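(* Let $f\in\Gamma_0(\mathcal H)$ be continuously differentiable with non-empty set of minimizers and minimum value $f^*$, and let $(X(t),Z(t))$, $t\ge0$, be the solution to $$Z=b_t\dot X+c_tL^{-1}\nabla f(X)+X,\qquad \dot Z=-a_tL^{-1}\nabla f(X),\qquad Z(0)=X(0)=x_0 .$$ Suppose that: (i) $A_t=a_tb_t$, and there exists a constant $d\in(0,1)$ such that $0\le\dot A_t\le d\,a_t$; (ii) $c_t$ is differentiable and $\sup_{t>0}\dfrac{\dot c_t}{a_t}<\infty$; (iii) there exist a positive constant $\gamma$ and a non-negative constant $t_0$ such that $c_t\le\gamma a_t$ for all $t\ge t_0$; (iv) the limit $\beta:=\lim_{t\to\infty}\dfrac{t}{b_t}$ exists and lies in $(0,\infty)$. Then $$\lim_{t\to\infty}A_t[f(X(t))-f^*]=0 .$$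
   Context: $\mathcal H$ is a real Hilbert space with inner product $\langle\cdot,\cdot\rangle$ and norm $\|\cdot\|$. $\Gamma_0(\mathcal H)$ is the set of closed, proper, convex functions on $\mathcal H$. $L:\mathcal H\to\mathcal H$ is a positive definite operator (bounded, linear, self-adjoint, with inverse $L^{-1}$ defined on $\mathcal H$). The coefficients $a_t,b_t,c_t$ are real functions of $t\in[0,\infty)$, positive on $(0,\infty)$ and non-negative at $0$, and $a_tb_t$ is differentiable in $t$. A dot denotes the derivative in $t$. A solution is a pair of functions $X,Z:[0,\infty)\to\mathcal H$, continuous on $[0,\infty)$ and differentiable on $(0,\infty)$, satisfying the system for $t>0$ and the initial condition. *)

theory Defs
  imports "HOL-Analysis.Analysis"
begin

definition ereal_epigraph :: "('a \<Rightarrow> ereal) \<Rightarrow> ('a \<times> real) set" where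
  "ereal_epigraph F = {(x, r). F x \<le> ereal r}"

definition Gamma0 :: "('a::real_inner \<Rightarrow> ereal) set" where
  "Gamma0 = {F. closed (ereal_epigraph F) \<and> convex (ereal_epigraph F) \<and>
                (\<forall>x. F x \<noteq> -\<infinity>) \<and> (\<exists>x. F x \<noteq> \<infinity>)}"

definition minimizers :: "('a \<Rightarrow> real) \<Rightarrow> 'a set" where
  "minimizers f = {x. \<forall>y. f x \<le> f y}"

definition continuously_differentiable_with_gradient ::
    "('a::real_inner \<Rightarrow> real) \<Rightarrow> ('a \<Rightarrow> 'a) \<Rightarrow> bool" where
  "continuously_differentiable_with_gradient f g \<longleftrightarrow>
     (\<forall>x. GDERIV f x :> g x) \<and> continuous_on UNIV g"

(* Together with self-adjointness, strict positivity and boundedness, bijectivity on the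
   complete space forces the inverse to be bounded and L to be coercive. *)
definition positive_definite_operator :: "('a::real_inner \<Rightarrow> 'a) \<Rightarrow> bool" where
  "positive_definite_operator L \<longleftrightarrow>
     bounded_linear L \<and> (\<forall>x y. inner (L x) y = inner x (L y)) \<and>
     (\<forall>x. x \<noteq> 0 \<longrightarrow> 0 < inner (L x) x) \<and> bij L"

(* Functions on [0,oo) are modelled as total functions on the reals; their values at
   negative arguments play no role. *)
definition admissible_coefficient :: "(real \<Rightarrow> real) \<Rightarrow> bool" where
  "admissible_coefficient a \<longleftrightarrow> 0 \<le> a 0 \<and> (\<forall>t>0. 0 < a t)"

(* The argument g is the gradient field, taken with respect to the ambient inner product. *)
definition is_solution ::
    "('a::real_inner \<Rightarrow> 'a) \<Rightarrow> ('a \<Rightarrow> 'a) \<Rightarrow> (real \<Rightarrow> real) \<Rightarrow> (real \<Rightarrow> real) \<Rightarrow> (real \<Rightarrow> real) \<Rightarrow>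
     'a \<Rightarrow> (real \<Rightarrow> 'a) \<Rightarrow> (real \<Rightarrow> 'a) \<Rightarrow> bool" where
  "is_solution L g a b c x0 X Z \<longleftrightarrow>
     continuous_on {0..} X \<and> continuous_on {0..} Z \<and> X 0 = x0 \<and> Z 0 = x0 \<and>
     (\<forall>t>0. X differentiable (at t) \<and> Z differentiable (at t) \<and>
        Z t = b t *\<^sub>R vector_derivative X (at t) + c t *\<^sub>R inv L (g (X t)) + X t \<and>
        vector_derivative Z (at t) = - (a t *\<^sub>R inv L (g (X t))))"

end

theory Submission
  imports Defs
begin

text \<open>
  Write \<open>\<phi> = f(X) - f\<^sup>*\<close>, \<open>N(u) = \<langle>L u, u\<rangle>\<close> and \<open>P = L\<^sup>-\<^sup>1 \<nabla>f(X)\<close>.  Two energies are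
  used: the anchored one, \<open>E = A \<phi> + N(Z - x\<^sup>*) / 2\<close> with a minimizer \<open>x\<^sup>*\<close>, and the unanchored one,
  \<open>G = (A + c) \<phi> + N(Z - X) / 2\<close>.  Convexity and \<open>A' \<le> d a\<close> make \<open>E\<close> decrease at rate at least
  \<open>(1 - d) a \<phi> + a c N(P)\<close>.  The weight \<open>A + c\<close> makes all cross terms in \<open>G'\<close> cancel, so that
  \<open>G' = (A' + c') \<phi> - a c N(P) - b N(X')\<close>; its only possibly positive part is at most a multiple of
  \<open>a \<phi>\<close>, which \<open>E\<close> dissipates.  Hence \<open>H = G + K E\<close> decreases for \<open>K\<close> large, at rate at least
  \<open>a \<phi> + a c N(P) + b N(X')\<close>.

  Both \<open>E\<close> and \<open>H\<close> are non-negative and decreasing, so they converge, and therefore so does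
  \<open>G = H - K E\<close>.  On the other hand \<open>Z - X = b X' + c P\<close> and \<open>c \<le> \<gamma> a\<close> give
  \<open>G / b \<le> (1 + \<gamma>) (a \<phi> + a c N(P) + b N(X'))\<close> as soon as \<open>b \<ge> 1\<close>, so \<open>H' \<le> - \<kappa> G / b\<close> with
  \<open>\<kappa> = 1 / (1 + \<gamma>)\<close>.  Since \<open>1 / b\<close> behaves like \<open>\<beta> / t\<close>, whose integral diverges, a positive limit of
  \<open>G\<close> would drive \<open>H\<close> to minus infinity.  Thus \<open>G\<close> tends to zero, and \<open>0 \<le> A \<phi> \<le> G\<close>.
\<close>

section \<open>Monotone functions on a half-line\<close>

lemma decreasing_bounded_below_convergent:
  fixes h :: "real \<Rightarrow> real"
  assumes der: "\<And>t. T \<le> t \<Longrightarrow> (h has_real_derivative h' t) (at t)"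
    and nonpos: "\<And>t. T \<le> t \<Longrightarrow> h' t \<le> 0"
    and lower: "\<And>t. T \<le> t \<Longrightarrow> m \<le> h t"
  obtains l where "(h \<longlongrightarrow> l) at_top"
proof -
  have anti: "h t \<le> h s" if "T \<le> s" "s \<le> t" for s t
    using that by (intro DERIV_nonpos_imp_nonincreasing[OF \<open>s \<le> t\<close>]) (meson der nonpos order_trans)
  have bdd: "bdd_below (h ` {T..})"
    using lower by (auto intro!: bdd_belowI2)
  have "(h \<longlongrightarrow> (INF t\<in>{T..}. h t)) at_top"
  proof (rule decreasing_tendsto)
    show "\<forall>\<^sub>F t in at_top. (INF t\<in>{T..}. h t) \<le> h t"
      using eventually_ge_at_top[of T] by eventually_elim (auto intro!: cINF_lower bdd)
    fix x assume "(INF t\<in>{T..}. h t) < x"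
    then obtain s where s: "T \<le> s" "h s < x"
      using bdd by (auto simp: cINF_less_iff)
    show "\<forall>\<^sub>F t in at_top. h t < x"
      using eventually_ge_at_top[of s] by eventually_elim (use s anti in force)
  qed
  then show thesis by (rule that)
qed

text \<open>
  If the limit \<open>l\<close> were positive then \<open>h'\<close> would eventually lie below \<open>- \<epsilon> / t\<close>
  for \<open>\<epsilon> = \<kappa> l \<beta> / 4\<close>, so \<open>h + \<epsilon> ln\<close> would be decreasing, contradicting \<open>h \<ge> 0\<close>.
\<close>
lemma limit_nonpos_if_dissipated_at_harmonic_rate:
  fixes h G b :: "real \<Rightarrow> real"
  assumes der: "\<And>t. T \<le> t \<Longrightarrow> (h has_real_derivative h' t) (at t)"
    and rate: "\<And>t. T \<le> t \<Longrightarrow> h' t \<le> - \<kappa> * (G t / b t)"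
    and h_nonneg: "\<And>t. T \<le> t \<Longrightarrow> 0 \<le> h t"
    and G: "(G \<longlongrightarrow> l) at_top"
    and b: "((\<lambda>t. t / b t) \<longlongrightarrow> \<beta>) at_top"
    and pos: "0 < \<kappa>" "0 < \<beta>"
  shows "l \<le> 0"
proof (rule ccontr)
  assume "\<not> l \<le> 0"
  then have l: "0 < l" by simp
  define \<epsilon> where "\<epsilon> = \<kappa> * (l / 2 * (\<beta> / 2))"
  have \<epsilon>: "0 < \<epsilon>" using l pos by (simp add: \<epsilon>_def)
  have "\<forall>\<^sub>F t in at_top. l / 2 < G t" "\<forall>\<^sub>F t in at_top. \<beta> / 2 < t / b t"
    using order_tendstoD(1)[OF G, of "l / 2"] order_tendstoD(1)[OF b, of "\<beta> / 2"] l pos by auto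
  then have "\<forall>\<^sub>F t in at_top. l / 2 < G t \<and> \<beta> / 2 < t / b t \<and> T \<le> t \<and> 1 \<le> t"
    using eventually_ge_at_top[of T] eventually_ge_at_top[of 1] by eventually_elim auto
  then obtain S where S: "\<And>t. S \<le> t \<Longrightarrow> l / 2 < G t \<and> \<beta> / 2 < t / b t \<and> T \<le> t \<and> 1 \<le> t"
    by (auto simp: eventually_at_top_linorder)
  have decr: "h t + \<epsilon> * ln t \<le> h S + \<epsilon> * ln S" if "S \<le> t" for t
  proof (rule DERIV_nonpos_imp_nonincreasing[OF that])
    fix s assume "S \<le> s" "s \<le> t"
    note s = S[OF \<open>S \<le> s\<close>]
    have "l / 2 * (\<beta> / 2) \<le> G s * (s / b s)"
      using s l pos by (intro mult_mono) auto
    then have "\<epsilon> \<le> \<kappa> * (G s * (s / b s))"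
      unfolding \<epsilon>_def using pos by (intro mult_left_mono) auto
    then have "\<epsilon> / s \<le> \<kappa> * (G s * (s / b s)) / s"
      using s by (intro divide_right_mono) auto
    also have "\<dots> = \<kappa> * (G s / b s)" using s by simp
    finally have "h' s + \<epsilon> / s \<le> 0" using rate[of s] s by simp
    moreover have "((\<lambda>t. h t + \<epsilon> * ln t) has_real_derivative h' s + \<epsilon> / s) (at s)"
      using DERIV_add[OF der DERIV_cmult[OF DERIV_ln_divide]] s by simp
    ultimately show "\<exists>y. ((\<lambda>t. h t + \<epsilon> * ln t) has_real_derivative y) (at s) \<and> y \<le> 0"
      by blast
  qed
  define C where "C = h S + \<epsilon> * ln S"
  have "\<forall>\<^sub>F t in at_top. C / \<epsilon> < ln t"
    using ln_at_top unfolding filterlim_at_top_dense by blast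
  then have "\<forall>\<^sub>F t in at_top. C / \<epsilon> < ln t \<and> S \<le> t"
    using eventually_ge_at_top[of S] by eventually_elim auto
  then obtain t where t: "C / \<epsilon> < ln t" "S \<le> t"
    by (auto dest: eventually_happens)
  have "C < \<epsilon> * ln t" using t \<epsilon> by (simp add: field_simps)
  moreover have "0 \<le> h t" using S[OF t(2)] h_nonneg by blast
  ultimately show False using decr[OF t(2)] by (simp add: C_def)
qed

section \<open>Convex functions and derivatives along curves\<close>

lemma convex_on_real_if_Gamma0:
  assumes "(\<lambda>x. ereal (f x)) \<in> Gamma0"
  shows "convex_on UNIV f"
proof -
  have "convex (ereal_epigraph (\<lambda>x. ereal (f x)))"
    using assms by (simp add: Gamma0_def)
  moreover have "ereal_epigraph (\<lambda>x. ereal (f x)) = epigraph UNIV f"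
    by (auto simp: ereal_epigraph_def epigraph_def)
  ultimately show ?thesis by (simp add: convex_epigraph)
qed

lemma has_real_derivative_along_curve:
  assumes "GDERIV f (X t) :> g" and "(X has_vector_derivative V) (at t)"
  shows "((\<lambda>t. f (X t)) has_real_derivative inner g V) (at t)"
proof -
  have "(f has_derivative (\<lambda>h. inner h g)) (at (X t))"
    using assms(1) by (simp add: gderiv_def)
  from has_derivative_compose[OF assms(2)[unfolded has_vector_derivative_def] this]
  show ?thesis
    by (simp add: has_field_derivative_def inner_commute mult_commute_abs)
qed

text \<open>The tangent inequality for convex functions of one variable, applied along the segment from
  \<open>x\<close> to \<open>y\<close>.\<close>
lemma convex_above_tangent_gradient:
  fixes f :: "'a::real_inner \<Rightarrow> real"
  assumes conv: "convex_on UNIV f" and g: "GDERIV f x :> g"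
  shows "f x + inner g (y - x) \<le> f y"
proof -
  define l where "l = (\<lambda>s::real. x + s *\<^sub>R (y - x))"
  have l_der: "(l has_vector_derivative y - x) (at 0)"
    unfolding l_def by (auto intro!: derivative_eq_intros)
  have der: "((\<lambda>s. f (l s)) has_real_derivative inner g (y - x)) (at 0)"
    using has_real_derivative_along_curve[OF _ l_der] g by (simp add: l_def)
  have "convex_on UNIV (\<lambda>s. f (l s))"
  proof (rule convex_onI)
    fix t r s :: real assume t: "0 < t" "t < 1"
    have "l ((1 - t) *\<^sub>R r + t *\<^sub>R s) = (1 - t) *\<^sub>R l r + t *\<^sub>R l s"
      by (simp add: l_def algebra_simps)
    then show "f (l ((1 - t) *\<^sub>R r + t *\<^sub>R s)) \<le> (1 - t) * f (l r) + t * f (l s)"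
      using convex_onD[OF conv, of t "l r" "l s"] t by simp
  qed auto
  then have "inner g (y - x) * (1 - 0) \<le> f (l 1) - f (l 0)"
    by (rule convex_on_imp_above_tangent) (use der in auto)
  then show ?thesis by (simp add: l_def)
qed

lemma has_real_derivative_quadratic_form:
  fixes L :: "'a::real_inner \<Rightarrow> 'a"
  assumes L: "bounded_linear L" and self_adjoint: "\<And>x y. inner (L x) y = inner x (L y)"
    and u: "(u has_vector_derivative u') (at t)"
  shows "((\<lambda>t. inner (L (u t)) (u t) / 2) has_real_derivative inner (L (u t)) u') (at t)"
proof -
  note u_der = u[unfolded has_vector_derivative_def]
  have "((\<lambda>t. inner (L (u t)) (u t)) has_derivative
         (\<lambda>h. inner (L (u t)) (h *\<^sub>R u') + inner (L (h *\<^sub>R u')) (u t))) (at t)"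
    by (intro has_derivative_inner u_der bounded_linear.has_derivative[OF L])
  moreover have "inner (L (h *\<^sub>R u')) (u t) = h * inner (L (u t)) u'" for h
    by (metis self_adjoint inner_commute inner_scaleR_left)
  then have "(\<lambda>h. inner (L (u t)) (h *\<^sub>R u') + inner (L (h *\<^sub>R u')) (u t)) =
             (*) (2 * inner (L (u t)) u')"
    by (simp add: fun_eq_iff)
  ultimately have "((\<lambda>t. inner (L (u t)) (u t)) has_real_derivative 2 * inner (L (u t)) u') (at t)"
    by (simp add: has_field_derivative_def)
  from DERIV_cdivide[OF this, of 2] show ?thesis by simp
qed

section \<open>The two energies of the flow\<close>

text \<open>
  The curve \<open>V\<close> is the velocity of \<open>X\<close>, and \<open>P\<close> is the gradient at \<open>X\<close> for the inner product
  \<open>\<langle>L u, v\<rangle>\<close>.  Describing \<open>P\<close> by \<open>L P = \<nabla>f(X)\<close> keeps the inverse of \<open>L\<close> out of the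
  calculations: every pairing with \<open>P\<close> turns into one with \<open>\<nabla>f(X)\<close>.
\<close>
locale preconditioned_inertial_flow =
  fixes L :: "'a::real_inner \<Rightarrow> 'a" and f :: "'a \<Rightarrow> real" and gradf :: "'a \<Rightarrow> 'a"
    and a b c A A' c' :: "real \<Rightarrow> real" and X Z V P :: "real \<Rightarrow> 'a" and xs :: 'a and d :: real
  assumes L_linear: "bounded_linear L"
    and L_self_adjoint: "\<And>x y. inner (L x) y = inner x (L y)"
    and L_nonneg: "\<And>x. 0 \<le> inner (L x) x"
    and gradient: "\<And>x. GDERIV f x :> gradf x"
    and f_convex: "convex_on UNIV f"
    and minimizer: "\<And>x. f xs \<le> f x"
    and a_pos: "\<And>t. 0 < t \<Longrightarrow> 0 < a t"
    and b_pos: "\<And>t. 0 < t \<Longrightarrow> 0 < b t"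
    and c_pos: "\<And>t. 0 < t \<Longrightarrow> 0 < c t"
    and A_eq: "\<And>t. A t = a t * b t"
    and A_deriv: "\<And>t. 0 < t \<Longrightarrow> (A has_real_derivative A' t) (at t)"
    and c_deriv: "\<And>t. 0 < t \<Longrightarrow> (c has_real_derivative c' t) (at t)"
    and d_less: "d < 1"
    and A'_le: "\<And>t. 0 < t \<Longrightarrow> A' t \<le> d * a t"
    and X_deriv: "\<And>t. 0 < t \<Longrightarrow> (X has_vector_derivative V t) (at t)"
    and Z_deriv: "\<And>t. 0 < t \<Longrightarrow> (Z has_vector_derivative - (a t *\<^sub>R P t)) (at t)"
    and Z_eq: "\<And>t. 0 < t \<Longrightarrow> Z t = b t *\<^sub>R V t + c t *\<^sub>R P t + X t"
    and L_P: "\<And>t. 0 < t \<Longrightarrow> L (P t) = gradf (X t)"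
begin

definition N :: "'a \<Rightarrow> real" where "N u = inner (L u) u"

definition gap :: "real \<Rightarrow> real" where "gap t = f (X t) - f xs"

definition anchored_energy :: "real \<Rightarrow> real" where
  "anchored_energy t = A t * gap t + N (Z t - xs) / 2"

definition unanchored_energy :: "real \<Rightarrow> real" where
  "unanchored_energy t = (A t + c t) * gap t + N (Z t - X t) / 2"

lemma N_nonneg: "0 \<le> N u"
  by (simp add: N_def L_nonneg)

lemma gap_nonneg: "0 \<le> gap t"
  by (simp add: gap_def minimizer)

lemma A_pos: "0 < t \<Longrightarrow> 0 < A t"
  by (simp add: A_eq a_pos b_pos)

lemma anchored_energy_nonneg: "0 < t \<Longrightarrow> 0 \<le> anchored_energy t"
  using A_pos[of t] by (simp add: anchored_energy_def N_nonneg gap_nonneg)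

lemma weighted_gap_le_unanchored_energy: "0 < t \<Longrightarrow> A t * gap t \<le> unanchored_energy t"
  using c_pos[of t] by (simp add: unanchored_energy_def N_nonneg gap_nonneg distrib_right)

lemma unanchored_energy_nonneg: "0 < t \<Longrightarrow> 0 \<le> unanchored_energy t"
  using weighted_gap_le_unanchored_energy[of t] A_pos[of t] gap_nonneg[of t]
  by (smt (verit) mult_nonneg_nonneg)

lemma gap_deriv:
  "0 < t \<Longrightarrow> (gap has_real_derivative inner (gradf (X t)) (V t)) (at t)"
  unfolding gap_def
  using DERIV_diff[OF has_real_derivative_along_curve[OF gradient X_deriv] DERIV_const] by simp

lemma N_deriv:
  "(u has_vector_derivative u') (at t) \<Longrightarrow>
     ((\<lambda>t. N (u t) / 2) has_real_derivative inner (L (u t)) u') (at t)"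
  unfolding N_def by (rule has_real_derivative_quadratic_form[OF L_linear L_self_adjoint])

lemma inner_L_P: "0 < t \<Longrightarrow> inner (L u) (P t) = inner (gradf (X t)) u"
  by (metis L_P L_self_adjoint inner_commute)

text \<open>Substituting \<open>b V = Z - X - c P\<close> turns \<open>A \<langle>\<nabla>f(X), V\<rangle>\<close> into
  \<open>a \<langle>\<nabla>f(X), Z - X - c P\<rangle>\<close>, and the part containing \<open>Z\<close> cancels against the derivative of
  \<open>N(Z - x\<^sup>*) / 2\<close>.\<close>
lemma anchored_energy_deriv:
  assumes t: "0 < t"
  shows "(anchored_energy has_real_derivative
           A' t * gap t - a t * inner (gradf (X t)) (X t - xs) - a t * c t * N (P t)) (at t)"
proof -
  let ?g = "gradf (X t)"
  have "((\<lambda>t. Z t - xs) has_vector_derivative - (a t *\<^sub>R P t)) (at t)"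
    using has_vector_derivative_diff[OF Z_deriv[OF t] has_vector_derivative_const] by simp
  note N_der = N_deriv[OF this]
  have der: "(anchored_energy has_real_derivative
      A t * inner ?g (V t) + A' t * gap t + inner (L (Z t - xs)) (- (a t *\<^sub>R P t))) (at t)"
    unfolding anchored_energy_def
    using DERIV_add[OF DERIV_mult'[OF A_deriv[OF t] gap_deriv[OF t]] N_der] by simp
  have "inner (L (Z t - xs)) (- (a t *\<^sub>R P t)) = - (a t * inner ?g (Z t - xs))"
    using inner_L_P[OF t, of "Z t - xs"] by simp
  also have "inner ?g (Z t - xs) = b t * inner ?g (V t) + c t * N (P t) + inner ?g (X t - xs)"
    using L_P[OF t] Z_eq[OF t] by (simp add: N_def inner_add_right inner_diff_right)
  finally have eq: "inner (L (Z t - xs)) (- (a t *\<^sub>R P t)) =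
      - (a t * (b t * inner ?g (V t) + c t * N (P t) + inner ?g (X t - xs)))" .
  show ?thesis using der unfolding eq by (simp add: A_eq algebra_simps)
qed

lemma anchored_energy_dissipation:
  assumes t: "0 < t"
  shows "A' t * gap t - a t * inner (gradf (X t)) (X t - xs) - a t * c t * N (P t)
         \<le> - (1 - d) * (a t * gap t) - a t * c t * N (P t)"
proof -
  have "gap t \<le> inner (gradf (X t)) (X t - xs)"
    using convex_above_tangent_gradient[OF f_convex gradient, of "X t" xs]
    by (simp add: gap_def inner_diff_right)
  then have "a t * gap t \<le> a t * inner (gradf (X t)) (X t - xs)"
    using a_pos[OF t] by (intro mult_left_mono) auto
  moreover have "A' t * gap t \<le> d * a t * gap t"
    using A'_le[OF t] gap_nonneg by (intro mult_right_mono) auto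
  ultimately show ?thesis by (simp add: algebra_simps)
qed

text \<open>Here the cross terms \<open>A \<langle>\<nabla>f(X), V\<rangle>\<close> and \<open>c \<langle>\<nabla>f(X), V\<rangle>\<close> both cancel; the weight
  \<open>A + c\<close> of the gap is chosen for this.\<close>
lemma unanchored_energy_deriv:
  assumes t: "0 < t"
  shows "(unanchored_energy has_real_derivative
           (A' t + c' t) * gap t - a t * c t * N (P t) - b t * N (V t)) (at t)"
proof -
  let ?g = "gradf (X t)"
  interpret bounded_linear L by (rule L_linear)
  note N_der = N_deriv[OF has_vector_derivative_diff[OF Z_deriv[OF t] X_deriv[OF t]]]
  have der: "(unanchored_energy has_real_derivative
      (A t + c t) * inner ?g (V t) + (A' t + c' t) * gap t
        + inner (L (Z t - X t)) (- (a t *\<^sub>R P t) - V t)) (at t)"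
    unfolding unanchored_energy_def
    using DERIV_add[OF DERIV_mult'[OF DERIV_add[OF A_deriv[OF t] c_deriv[OF t]] gap_deriv[OF t]] N_der]
    by simp
  have "inner (L (Z t - X t)) (- (a t *\<^sub>R P t) - V t) =
        - (a t * inner ?g (Z t - X t)) - inner (L (Z t - X t)) (V t)"
    using inner_L_P[OF t, of "Z t - X t"] by (simp add: inner_diff_right)
  also have "inner ?g (Z t - X t) = b t * inner ?g (V t) + c t * N (P t)"
    using Z_eq[OF t] L_P[OF t] by (simp add: N_def inner_add_right)
  also have "inner (L (Z t - X t)) (V t) = b t * N (V t) + c t * inner ?g (V t)"
    using Z_eq[OF t] L_P[OF t] by (simp add: N_def add scaleR inner_add_left)
  finally have eq: "inner (L (Z t - X t)) (- (a t *\<^sub>R P t) - V t) =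
      - (a t * (b t * inner ?g (V t) + c t * N (P t))) - (b t * N (V t) + c t * inner ?g (V t))" .
  show ?thesis using der unfolding eq by (simp add: A_eq algebra_simps)
qed

lemma N_half_sum_le: "N (u + v) / 2 \<le> N u + N v"
proof -
  interpret bounded_linear L by (rule L_linear)
  have "N (u + v) + N (u - v) = 2 * N u + 2 * N v"
    by (simp add: N_def add diff inner_add_left inner_add_right inner_diff_left inner_diff_right)
  then show ?thesis using N_nonneg[of "u - v"] by simp
qed

lemma N_scaleR: "N (r *\<^sub>R u) = r\<^sup>2 * N u"
  by (simp add: N_def linear_simps[OF L_linear] power2_eq_square)

lemma unanchored_energy_le_dissipation:
  assumes t: "0 < t" and b1: "1 \<le> b t" and c_le: "c t \<le> \<gamma> * a t" and \<gamma>: "0 \<le> \<gamma>"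
  shows "unanchored_energy t / b t
         \<le> (1 + \<gamma>) * (a t * gap t + a t * c t * N (P t) + b t * N (V t))"
proof -
  note pos = a_pos[OF t] b_pos[OF t] c_pos[OF t] N_nonneg[of "P t"] N_nonneg[of "V t"]
    gap_nonneg[of t]
  have c_b: "c t / b t \<le> \<gamma> * a t"
  proof -
    have "c t / b t \<le> c t / 1" using b1 pos by (intro divide_left_mono) auto
    with c_le show ?thesis by simp
  qed
  have "N (Z t - X t) / 2 \<le> (b t)\<^sup>2 * N (V t) + (c t)\<^sup>2 * N (P t)"
    using N_half_sum_le[of "b t *\<^sub>R V t" "c t *\<^sub>R P t"] Z_eq[OF t] by (simp add: N_scaleR)
  then have "unanchored_energy t
      \<le> (A t + c t) * gap t + ((b t)\<^sup>2 * N (V t) + (c t)\<^sup>2 * N (P t))"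
    by (simp add: unanchored_energy_def)
  then have "unanchored_energy t / b t
      \<le> ((A t + c t) * gap t + ((b t)\<^sup>2 * N (V t) + (c t)\<^sup>2 * N (P t))) / b t"
    using pos by (intro divide_right_mono) auto
  also have "\<dots> = a t * gap t + (c t / b t) * gap t + b t * N (V t) + (c t / b t) * (c t * N (P t))"
    using pos by (simp add: A_eq field_simps power2_eq_square)
  also have "\<dots> \<le> a t * gap t + (\<gamma> * a t) * gap t + b t * N (V t) + (\<gamma> * a t) * (c t * N (P t))"
    using c_b pos by (intro add_mono mult_right_mono order_refl) auto
  also have "\<dots> \<le> (1 + \<gamma>) * (a t * gap t + a t * c t * N (P t) + b t * N (V t))"
    using pos \<gamma> by (simp add: algebra_simps)
  finally show ?thesis .
qed

text \<open>The constant \<open>K\<close> is chosen so that the dissipation of \<open>K E\<close> exceeds the growth of \<open>G\<close>, at most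
  \<open>(d + M) a \<phi>\<close>, by at least \<open>a \<phi>\<close>.\<close>
theorem weighted_gap_tendsto_0:
  assumes c'_le: "\<And>t. 0 < t \<Longrightarrow> c' t \<le> M * a t"
    and c_le: "\<And>t. t0 \<le> t \<Longrightarrow> c t \<le> \<gamma> * a t" and \<gamma>: "0 \<le> \<gamma>"
    and b_lim: "((\<lambda>t. t / b t) \<longlongrightarrow> \<beta>) at_top" and \<beta>: "0 < \<beta>"
  shows "((\<lambda>t. A t * gap t) \<longlongrightarrow> 0) at_top"
proof -
  define K where "K = max 0 ((d + M + 1) / (1 - d))"
  define E' where "E' t = A' t * gap t - a t * inner (gradf (X t)) (X t - xs) - a t * c t * N (P t)" for t
  define G' where "G' t = (A' t + c' t) * gap t - a t * c t * N (P t) - b t * N (V t)" for t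
  define H where "H t = unanchored_energy t + K * anchored_energy t" for t
  define D where "D t = a t * gap t + a t * c t * N (P t) + b t * N (V t)" for t
  have K0: "0 \<le> K" by (simp add: K_def)
  have K1: "d + M + 1 \<le> K * (1 - d)"
    using d_less by (simp add: K_def pos_divide_le_eq[symmetric])
  have E_der: "(anchored_energy has_real_derivative E' t) (at t)" if "0 < t" for t
    using anchored_energy_deriv[OF that] by (simp add: E'_def)
  have H_der: "(H has_real_derivative G' t + K * E' t) (at t)" if "0 < t" for t
    unfolding H_def G'_def
    by (intro DERIV_add DERIV_cmult E_der unanchored_energy_deriv that)
  have D_nonneg: "0 \<le> D t" if "0 < t" for t
    using a_pos[OF that] b_pos[OF that] c_pos[OF that] by (simp add: D_def gap_nonneg N_nonneg)
  have E'_le: "E' t \<le> - (1 - d) * (a t * gap t)" if t: "0 < t" for t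
  proof -
    have "0 \<le> a t * c t * N (P t)"
      using a_pos[OF t] c_pos[OF t] by (simp add: N_nonneg)
    with anchored_energy_dissipation[OF t] show ?thesis by (simp add: E'_def)
  qed
  have H'_le: "G' t + K * E' t \<le> - D t" if t: "0 < t" for t
  proof -
    have ag: "0 \<le> a t * gap t" using a_pos[OF t] by (simp add: gap_nonneg)
    have "(A' t + c' t) * gap t \<le> (d * a t + M * a t) * gap t"
      using A'_le[OF t] c'_le[OF t] by (intro mult_right_mono) (auto simp: gap_nonneg)
    moreover have "K * E' t \<le> - (K * (1 - d)) * (a t * gap t)"
      using mult_left_mono[OF E'_le[OF t] K0] by (simp add: algebra_simps)
    moreover have "(d + M + 1) * (a t * gap t) \<le> K * (1 - d) * (a t * gap t)"
      using K1 ag by (rule mult_right_mono)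
    ultimately show ?thesis by (simp add: G'_def D_def algebra_simps)
  qed
  have H_nonneg: "0 \<le> H t" if "0 < t" for t
    using anchored_energy_nonneg[OF that] unanchored_energy_nonneg[OF that] K0 by (simp add: H_def)
  obtain lE where lE: "(anchored_energy \<longlongrightarrow> lE) at_top"
  proof (rule decreasing_bounded_below_convergent)
    show "(anchored_energy has_real_derivative E' t) (at t)" if "1 \<le> t" for t
      using E_der that by simp
    show "E' t \<le> 0" if "1 \<le> t" for t
    proof -
      have "0 \<le> (1 - d) * (a t * gap t)"
        using d_less a_pos[of t] that by (simp add: gap_nonneg)
      with E'_le[of t] that show ?thesis by (simp add: algebra_simps)
    qed
    show "0 \<le> anchored_energy t" if "1 \<le> t" for t
      using anchored_energy_nonneg that by simp
  qed
  obtain lH where lH: "(H \<longlongrightarrow> lH) at_top"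
  proof (rule decreasing_bounded_below_convergent)
    show "(H has_real_derivative G' t + K * E' t) (at t)" if "1 \<le> t" for t
      using H_der that by simp
    show "G' t + K * E' t \<le> 0" if "1 \<le> t" for t
      using H'_le[of t] D_nonneg[of t] that by simp
    show "0 \<le> H t" if "1 \<le> t" for t
      using H_nonneg that by simp
  qed
  define l where "l = lH - K * lE"
  have "((\<lambda>t. H t - K * anchored_energy t) \<longlongrightarrow> l) at_top"
    unfolding l_def by (intro tendsto_intros lE lH)
  then have G_lim: "(unanchored_energy \<longlongrightarrow> l) at_top"
    by (simp add: H_def)
  \<comment> \<open>Once \<open>t / b t < \<beta> + 1 \<le> t\<close>, the coefficient \<open>b t\<close> exceeds 1, as the comparison of
    \<open>G / b\<close> with the dissipation requires.\<close>
  have "\<forall>\<^sub>F t in at_top. t / b t < \<beta> + 1"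
    using order_tendstoD(2)[OF b_lim, of "\<beta> + 1"] by simp
  then have b_ge: "\<forall>\<^sub>F t in at_top. 1 \<le> b t"
    using eventually_ge_at_top[of "\<beta> + 1"]
  proof eventually_elim
    fix t assume t: "t / b t < \<beta> + 1" "\<beta> + 1 \<le> t"
    then have "0 < b t" using b_pos \<beta> by simp
    with t have "t < (\<beta> + 1) * b t" by (simp add: pos_divide_less_eq)
    with t have "(\<beta> + 1) * 1 < (\<beta> + 1) * b t" by simp
    then show "1 \<le> b t" using \<beta> by (simp add: mult_less_cancel_left_pos)
  qed
  then have "\<forall>\<^sub>F t in at_top. 1 \<le> b t \<and> t0 \<le> t \<and> 1 \<le> t"
    using eventually_ge_at_top[of t0] eventually_ge_at_top[of 1] by eventually_elim auto
  then obtain T where T: "\<And>t. T \<le> t \<Longrightarrow> 1 \<le> b t \<and> t0 \<le> t \<and> 1 \<le> t"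
    by (auto simp: eventually_at_top_linorder)
  have "l \<le> 0"
  proof (rule limit_nonpos_if_dissipated_at_harmonic_rate[OF _ _ _ G_lim b_lim _ \<beta>])
    fix t assume "T \<le> t"
    note t = T[OF this]
    show "(H has_real_derivative G' t + K * E' t) (at t)" using H_der t by simp
    show "0 \<le> H t" using H_nonneg t by simp
    have "unanchored_energy t / b t \<le> (1 + \<gamma>) * D t"
      using unanchored_energy_le_dissipation[of t \<gamma>] t c_le \<gamma> by (simp add: D_def)
    then have "1 / (1 + \<gamma>) * (unanchored_energy t / b t) \<le> D t"
      using \<gamma>
      by (simp only: times_divide_eq_left mult_1_left)
         (simp add: pos_divide_le_eq mult.commute del: divide_divide_eq_left)
    with H'_le[of t] t
    show "G' t + K * E' t \<le> - (1 / (1 + \<gamma>)) * (unanchored_energy t / b t)" by simp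
  next
    show "0 < 1 / (1 + \<gamma>)" using \<gamma> by simp
  qed
  moreover have "0 \<le> l"
  proof (rule tendsto_lowerbound[OF G_lim])
    show "\<forall>\<^sub>F t in at_top. 0 \<le> unanchored_energy t"
      using eventually_gt_at_top[of 0] by eventually_elim (rule unanchored_energy_nonneg)
  qed simp
  ultimately have G0: "(unanchored_energy \<longlongrightarrow> 0) at_top" using G_lim by simp
  show ?thesis
  proof (rule tendsto_sandwich[OF _ _ tendsto_const G0])
    show "\<forall>\<^sub>F t in at_top. 0 \<le> A t * gap t"
      using eventually_gt_at_top[of 0]
      by eventually_elim (simp add: A_pos gap_nonneg less_imp_le)
    show "\<forall>\<^sub>F t in at_top. A t * gap t \<le> unanchored_energy t"
      using eventually_gt_at_top[of 0] by eventually_elim (rule weighted_gap_le_unanchored_energy)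
  qed
qed

end

section \<open>Convergence of the weighted function values\<close>

theorem theorem3:
  fixes f :: "'a::{real_inner, complete_space} \<Rightarrow> real"
    and gradf :: "'a \<Rightarrow> 'a" and L :: "'a \<Rightarrow> 'a"
    and a b c A :: "real \<Rightarrow> real" and X Z :: "real \<Rightarrow> 'a"
    and x0 :: 'a and fstar d \<gamma> t0 \<beta> :: real
  assumes L: "positive_definite_operator L"
    and coeffs: "admissible_coefficient a" "admissible_coefficient b" "admissible_coefficient c"
    and A_def: "\<And>t. A t = a t * b t"
    and A_diff: "\<And>t. 0 < t \<Longrightarrow> A differentiable (at t)"
    and f_Gamma0: "(\<lambda>x. ereal (f x)) \<in> Gamma0"
    and f_C1: "continuously_differentiable_with_gradient f gradf"
    and f_min: "minimizers f \<noteq> {}" and fstar: "fstar = (INF x. f x)"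
    and sol: "is_solution L gradf a b c x0 X Z"
    and i: "0 < d" "d < 1" "\<And>t. 0 < t \<Longrightarrow> 0 \<le> deriv A t \<and> deriv A t \<le> d * a t"
    and ii: "\<And>t. 0 < t \<Longrightarrow> c differentiable (at t)"
            "bdd_above ((\<lambda>t. deriv c t / a t) ` {0<..})"
    and iii: "0 < \<gamma>" "0 \<le> t0" "\<And>t. t0 \<le> t \<Longrightarrow> c t \<le> \<gamma> * a t"
    and iv: "((\<lambda>t. t / b t) \<longlongrightarrow> \<beta>) at_top" "0 < \<beta>"
  shows "((\<lambda>t. A t * (f (X t) - fstar)) \<longlongrightarrow> 0) at_top"
proof -
  obtain xs where xs: "\<And>y. f xs \<le> f y"
    using f_min by (auto simp: minimizers_def)
  have fstar_eq: "fstar = f xs"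
    unfolding fstar by (rule cInf_eq_minimum) (auto intro: xs)
  obtain M where M: "\<And>t. 0 < t \<Longrightarrow> deriv c t / a t \<le> M"
    using ii(2) by (auto simp: bdd_above_def)
  have L_inv: "L (inv L x) = x" for x
    using L by (simp add: positive_definite_operator_def bij_is_surj surj_f_inv_f)
  have a_pos: "0 < a t" if "0 < t" for t
    using coeffs that by (simp add: admissible_coefficient_def)
  have at_t: "X differentiable (at t)" "Z differentiable (at t)"
    "Z t = b t *\<^sub>R vector_derivative X (at t) + c t *\<^sub>R inv L (gradf (X t)) + X t"
    "vector_derivative Z (at t) = - (a t *\<^sub>R inv L (gradf (X t)))" if "0 < t" for t
    using sol that by (auto simp: is_solution_def)
  interpret preconditioned_inertial_flow L f gradf a b c A "deriv A" "deriv c" X Z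
    "\<lambda>t. vector_derivative X (at t)" "\<lambda>t. inv L (gradf (X t))" xs d
  proof (rule preconditioned_inertial_flow.intro)
    show "bounded_linear L"
      using L by (auto simp: positive_definite_operator_def)
    then have "L 0 = 0" by (simp add: linear_simps)
    then show "\<And>x. 0 \<le> inner (L x) x"
      using L by (metis positive_definite_operator_def inner_zero_right less_imp_le order_refl)
    show "\<And>x y. inner (L x) y = inner x (L y)"
      using L by (auto simp: positive_definite_operator_def)
    show "\<And>x. GDERIV f x :> gradf x"
      using f_C1 by (simp add: continuously_differentiable_with_gradient_def)
    show "convex_on UNIV f" using f_Gamma0 by (rule convex_on_real_if_Gamma0)
    show "\<And>t. 0 < t \<Longrightarrow> 0 < b t" "\<And>t. 0 < t \<Longrightarrow> 0 < c t"
      using coeffs by (auto simp: admissible_coefficient_def)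
    show "\<And>t. 0 < t \<Longrightarrow> (A has_real_derivative deriv A t) (at t)"
      "\<And>t. 0 < t \<Longrightarrow> (c has_real_derivative deriv c t) (at t)"
      using A_diff ii(1)
      by (auto simp: DERIV_deriv_iff_real_differentiable)
    show "\<And>t. 0 < t \<Longrightarrow> (X has_vector_derivative vector_derivative X (at t)) (at t)"
      using at_t(1) by (simp add: vector_derivative_works)
    show "\<And>t. 0 < t \<Longrightarrow> (Z has_vector_derivative - (a t *\<^sub>R inv L (gradf (X t)))) (at t)"
      using at_t(2,4) by (metis vector_derivative_works)
  qed (use xs a_pos A_def i at_t(3) L_inv in auto)
  have "((\<lambda>t. A t * gap t) \<longlongrightarrow> 0) at_top"
  proof (rule weighted_gap_tendsto_0)
    show "\<And>t. 0 < t \<Longrightarrow> deriv c t \<le> M * a t"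
      using M a_pos by (simp add: pos_divide_le_eq)
    show "\<And>t. t0 \<le> t \<Longrightarrow> c t \<le> \<gamma> * a t" by (rule iii(3))
    show "((\<lambda>t. t / b t) \<longlongrightarrow> \<beta>) at_top" by (rule iv(1))
  qed (use iii(1) iv(2) in auto)
  then show ?thesis by (simp add: gap_def fstar_eq)
qed

end
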